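(* Let $X$ be a non-empty Lindelöf locally compact Hausdorff space, let $\mathcal{I}$ be a Riesz ideal of $C(X)$ and $\mathcal{R}$ a Riesz space. If $\Phi,\Psi\colon\mathcal{I}\to\mathcal{R}$ are two morphisms of Riesz spaces that are strictly $\mathcal{I}$-continuous and that coincide on a strictly point-separating and nowhere-vanishing subset $S$ of $\mathcal{I}$, then $\Phi=\Psi$.
   Context: $C(X)$ is the space of real-valued continuous functions on $X$ with pointwise operations and pointwise order; $|f|$ is the pointwise absolute value. A Riesz ideal of $C(X)$ is a linear subspace $\mathcal{I}\subseteq C(X)$ such that $f\in C(X)$, $g\in\mathcal{I}$ and $|f|\le|g|$ imply $f\in\mathcal{I}$; it is itself a Riesz space. A Riesz space (vector lattice) is an ordered real vector space $\mathcal{R}$ in which $|r|=\sup\{r,-r\}$ exists for all $r\in\mathcal{R}$. A morphism of Riesz spaces is a linear map $\Phi$ with $\Phi(|r|)=|\Phi(r)|$ for all $r$; it is in particular positive (maps elements $\geq 0$ to elements $\geq 0$). A positive linear map $\Phi\colon\mathcal{I}\to \mathcal{R}$ is strictly $\mathcal{I}$-continuous if for every decreasing sequence $(f_k)_{k\in\mathbb{N}}$ in $\mathcal{I}$ with pointwise infimum $0$ (i.e. $\inf_k f_k(x)=0$ for all $x\in X$), the decreasing sequence $(\Phi(f_k))_{k\in\mathbb{N}}$ in $\mathcal{R}$ has infimum $0$. A subset $S\subseteq C(X)$ is strictly point-separating if for all $x,y\in X$ with $x\ne y$ there is $s\in S$ with $s(x)\neq 0$ and $s(y)=0$; it is nowhere-vanishing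 if for every $x\in X$ there is $s\in S$ with $s(x)\ne 0$. *)

theory Defs
  imports "HOL-Analysis.Analysis" "HOL-Library.Lub_Glb"
begin

text \<open>Since suprema are unique, carrying the absolute value as a class operation only names the
  supremum whose existence is required of a Riesz space.\<close>

class riesz_space = ordered_real_vector + abs +
  assumes riesz_abs_upper: "r \<le> \<bar>r\<bar>" "- r \<le> \<bar>r\<bar>"
    and riesz_abs_least: "r \<le> s \<Longrightarrow> - r \<le> s \<Longrightarrow> \<bar>r\<bar> \<le> s"

text \<open>The underlying space is the whole of a (hence non-empty) type; operations on functions are
  pointwise, and the order on functions is the pointwise order of the library.\<close>

definition cont_fun_space :: "('x::topological_space \<Rightarrow> real) set" where
  "cont_fun_space = {f. continuous_on UNIV f}"

definition riesz_ideal :: "('x::topological_space \<Rightarrow> real) set \<Rightarrow> bool" where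
  "riesz_ideal I \<longleftrightarrow>
     I \<subseteq> cont_fun_space \<and>
     (\<lambda>x. 0) \<in> I \<and>
     (\<forall>f\<in>I. \<forall>g\<in>I. (\<lambda>x. f x + g x) \<in> I) \<and>
     (\<forall>c. \<forall>f\<in>I. (\<lambda>x. c * f x) \<in> I) \<and>
     (\<forall>f\<in>cont_fun_space. \<forall>g\<in>I. (\<forall>x. \<bar>f x\<bar> \<le> \<bar>g x\<bar>) \<longrightarrow> f \<in> I)"

text \<open>Maps on an ideal are total functions on the type of all real functions;
  only their values on the ideal matter.\<close>

definition riesz_morphism_on ::
    "('x \<Rightarrow> real) set \<Rightarrow> (('x \<Rightarrow> real) \<Rightarrow> 'r::riesz_space) \<Rightarrow> bool" where
  "riesz_morphism_on I \<Phi> \<longleftrightarrow>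
     (\<forall>f\<in>I. \<forall>g\<in>I. \<Phi> (\<lambda>x. f x + g x) = \<Phi> f + \<Phi> g) \<and>
     (\<forall>c. \<forall>f\<in>I. \<Phi> (\<lambda>x. c * f x) = c *\<^sub>R \<Phi> f) \<and>
     (\<forall>f\<in>I. \<Phi> (\<lambda>x. \<bar>f x\<bar>) = \<bar>\<Phi> f\<bar>)"

definition strictly_continuous_on ::
    "('x \<Rightarrow> real) set \<Rightarrow> (('x \<Rightarrow> real) \<Rightarrow> 'r::riesz_space) \<Rightarrow> bool" where
  "strictly_continuous_on I \<Phi> \<longleftrightarrow>
     (\<forall>F :: nat \<Rightarrow> 'x \<Rightarrow> real.
        range F \<subseteq> I \<and> decseq F \<and> (\<forall>x. isGlb UNIV (range (\<lambda>k. F k x)) 0) \<longrightarrow>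
        isGlb UNIV (range (\<lambda>k. \<Phi> (F k))) 0)"

definition strictly_point_separating :: "('x \<Rightarrow> real) set \<Rightarrow> bool" where
  "strictly_point_separating S \<longleftrightarrow> (\<forall>x y. x \<noteq> y \<longrightarrow> (\<exists>s\<in>S. s x \<noteq> 0 \<and> s y = 0))"

definition nowhere_vanishing :: "('x \<Rightarrow> real) set \<Rightarrow> bool" where
  "nowhere_vanishing S \<longleftrightarrow> (\<forall>x. \<exists>s\<in>S. s x \<noteq> 0)"

end

theory Submission
  imports Defs
begin

text \<open>The set \<open>T\<close> of those \<open>f \<in> I\<close> with \<open>\<Phi> f = \<Psi> f\<close> is a vector sublattice of \<open>I\<close>, because
  \<open>\<Phi>\<close> and \<open>\<Psi>\<close> are morphisms, and it is closed under decreasing pointwise limits of sequences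
  within \<open>I\<close>, because both maps are strictly continuous. It contains \<open>S\<close>. The claim is
  therefore one of Stone--Weierstrass type: a vector sublattice of \<open>I\<close> with this closure property
  that strictly separates points and vanishes nowhere is all of \<open>I\<close>.

  Consider a non-negative \<open>f \<in> I\<close> that is zero outside a compact set \<open>K\<close>. Two-point interpolation
  and compactness of \<open>K\<close> provide, for every point \<open>y\<close>, a function \<open>g \<in> T\<close> with \<open>f \<le> g\<close> and \<open>g y\<close>
  as close to \<open>f y\<close> as desired (lemma \<open>ex_majorant_close_at_point\<close>). Outside \<open>K\<close> the inequality
  costs nothing, since \<open>g\<close> can be taken non-negative; hence the values of \<open>g\<close> there need no
  control, and the majorants do not have to have compact support. So \<open>f\<close> is the pointwise infimum
  of its majorants in \<open>T\<close>, by the Lindelof property already of countably many of them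
  (lemma \<open>Lindelof_countable_pointwise_infimum\<close>), and their running minima decrease to \<open>f\<close>.
  Hence \<open>f \<in> T\<close>.

  An arbitrary non-negative \<open>f \<in> I\<close> is an increasing limit of functions of this kind
  (lemma \<open>ex_compactly_supported_approximation\<close>): local compactness and the Lindelof property give
  countably many compactly supported bump functions without common zero, and large multiples of
  their partial sums cut \<open>f\<close> off. Applied to the negatives, the closure property yields
  \<open>f \<in> T\<close>. Finally, every element of \<open>I\<close> is a difference of two non-negative ones.\<close>

section \<open>Vector sublattices of a function space\<close>

definition vector_sublattice :: "('x \<Rightarrow> real) set \<Rightarrow> bool" where
  "vector_sublattice T \<longleftrightarrow>
     (\<lambda>x. 0) \<in> T \<and>
     (\<forall>f\<in>T. \<forall>g\<in>T. (\<lambda>x. f x + g x) \<in> T) \<and>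
     (\<forall>c. \<forall>f\<in>T. (\<lambda>x. c * f x) \<in> T) \<and>
     (\<forall>f\<in>T. (\<lambda>x. \<bar>f x\<bar>) \<in> T)"

lemma vector_sublattice_zero: "vector_sublattice T \<Longrightarrow> (\<lambda>x. 0) \<in> T"
  and vector_sublattice_add:
    "vector_sublattice T \<Longrightarrow> f \<in> T \<Longrightarrow> g \<in> T \<Longrightarrow> (\<lambda>x. f x + g x) \<in> T"
  and vector_sublattice_scale: "vector_sublattice T \<Longrightarrow> f \<in> T \<Longrightarrow> (\<lambda>x. c * f x) \<in> T"
  and vector_sublattice_abs: "vector_sublattice T \<Longrightarrow> f \<in> T \<Longrightarrow> (\<lambda>x. \<bar>f x\<bar>) \<in> T"
  by (auto simp: vector_sublattice_def)

lemma vector_sublattice_diff: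
  assumes "vector_sublattice T" "f \<in> T" "g \<in> T"
  shows "(\<lambda>x. f x - g x) \<in> T"
  using vector_sublattice_add[OF assms(1,2) vector_sublattice_scale[OF assms(1,3), of "-1"]]
  by simp

lemma vector_sublattice_max:
  assumes T: "vector_sublattice T" "f \<in> T" "g \<in> T"
  shows "(\<lambda>x. max (f x) (g x)) \<in> T"
proof -
  have "(\<lambda>x. (1/2) * ((f x + g x) + \<bar>f x - g x\<bar>)) \<in> T"
    by (intro vector_sublattice_scale vector_sublattice_add vector_sublattice_abs
        vector_sublattice_diff T)
  also have "(\<lambda>x. (1/2) * ((f x + g x) + \<bar>f x - g x\<bar>)) = (\<lambda>x. max (f x) (g x))"
    by (auto simp: max_def)
  finally show ?thesis .
qed

lemma vector_sublattice_min:
  assumes T: "vector_sublattice T" "f \<in> T" "g \<in> T"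
  shows "(\<lambda>x. min (f x) (g x)) \<in> T"
proof -
  have "(\<lambda>x. (f x + g x) - max (f x) (g x)) \<in> T"
    by (intro vector_sublattice_diff vector_sublattice_add vector_sublattice_max T)
  also have "(\<lambda>x. (f x + g x) - max (f x) (g x)) = (\<lambda>x. min (f x) (g x))"
    by (auto simp: max_def min_def)
  finally show ?thesis .
qed

lemma vector_sublattice_finite_Max:
  assumes T: "vector_sublattice T" and "finite A" "A \<noteq> {}" "\<And>a. a \<in> A \<Longrightarrow> G a \<in> T"
  shows "(\<lambda>x. Max ((\<lambda>a. G a x) ` A)) \<in> T"
  using assms(2-)
proof (induction A rule: finite_ne_induct)
  case (singleton a)
  then show ?case by simp
next
  case (insert a A)
  then show ?case by (simp add: vector_sublattice_max[OF T])
qed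

lemma vector_sublattice_finite_Min:
  assumes T: "vector_sublattice T" and "finite A" "A \<noteq> {}" "\<And>a. a \<in> A \<Longrightarrow> G a \<in> T"
  shows "(\<lambda>x. Min ((\<lambda>a. G a x) ` A)) \<in> T"
  using assms(2-)
proof (induction A rule: finite_ne_induct)
  case (singleton a)
  then show ?case by simp
next
  case (insert a A)
  then show ?case by (simp add: vector_sublattice_min[OF T])
qed

lemma riesz_ideal_subset_cont_fun_space: "riesz_ideal I \<Longrightarrow> I \<subseteq> cont_fun_space"
  by (simp add: riesz_ideal_def)

lemma riesz_ideal_solid:
  assumes "riesz_ideal I" "f \<in> cont_fun_space" "g \<in> I" "\<And>x. \<bar>f x\<bar> \<le> \<bar>g x\<bar>"
  shows "f \<in> I"
proof -
  have "\<forall>f\<in>cont_fun_space. \<forall>g\<in>I. (\<forall>x. \<bar>f x\<bar> \<le> \<bar>g x\<bar>) \<longrightarrow> f \<in> I"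
    using assms(1) by (simp add: riesz_ideal_def)
  then show ?thesis
    using assms(2-4) by blast
qed

lemma riesz_ideal_vector_sublattice:
  assumes "riesz_ideal I"
  shows "vector_sublattice I"
proof -
  have "(\<lambda>x. \<bar>f x\<bar>) \<in> I" if "f \<in> I" for f
  proof -
    have "f \<in> cont_fun_space"
      using riesz_ideal_subset_cont_fun_space[OF assms] that ..
    then have "(\<lambda>x. \<bar>f x\<bar>) \<in> cont_fun_space"
      by (simp add: cont_fun_space_def continuous_on_rabs)
    then show ?thesis
      by (rule riesz_ideal_solid[OF assms _ that]) simp
  qed
  then show ?thesis
    using assms by (simp add: riesz_ideal_def vector_sublattice_def)
qed

text \<open>If \<open>s\<close> is zero at \<open>y\<close> but not at \<open>x\<close>, and \<open>t\<close> is zero at \<open>x\<close> but not at \<open>y\<close>, then multiples of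
  \<open>s\<close> and \<open>t\<close> prescribe the two values independently. If \<open>T\<close> merely
  separated \<open>x\<close> from \<open>y\<close>, the values at these two points could be proportional throughout \<open>T\<close>.\<close>

lemma vector_sublattice_interpolation:
  assumes T: "vector_sublattice T" and "strictly_point_separating T" and "x \<noteq> y"
  obtains g where "g \<in> T" "g x = a" "g y = b"
proof -
  obtain s t where s: "s \<in> T" "s x \<noteq> 0" "s y = 0" and t: "t \<in> T" "t y \<noteq> 0" "t x = 0"
    using assms(2,3) unfolding strictly_point_separating_def by metis
  show thesis
  proof
    show "(\<lambda>z. (a / s x) * s z + (b / t y) * t z) \<in> T"
      by (intro vector_sublattice_add vector_sublattice_scale T s t)
  qed (use s t in auto)
qed

section \<open>Approximation from above\<close>

lemma ex_majorant_close_at_point: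
  fixes T :: "('x::topological_space \<Rightarrow> real) set"
  assumes T: "vector_sublattice T" "T \<subseteq> cont_fun_space"
    and sep: "strictly_point_separating T" and nv: "nowhere_vanishing T"
    and f: "continuous_on UNIV f" "\<And>x. 0 \<le> f x"
    and K: "compact K" "\<And>x. x \<notin> K \<Longrightarrow> f x = 0"
    and "0 < \<epsilon>"
  obtains g where "g \<in> T" "\<And>x. f x \<le> g x" "g y < f y + \<epsilon>"
proof -
  have "\<exists>g\<in>T. f x < g x \<and> g y < f y + \<epsilon>" for x
  proof (cases "x = y")
    case True
    obtain s where s: "s \<in> T" "s y \<noteq> 0"
      using nv by (auto simp: nowhere_vanishing_def)
    have "(\<lambda>z. ((f y + \<epsilon>/2) / s y) * s z) \<in> T"
      by (intro vector_sublattice_scale T s)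
    then show ?thesis
      using s True \<open>0 < \<epsilon>\<close> by (intro bexI) auto
  next
    case False
    obtain g where "g \<in> T" "g x = f x + 1" "g y = f y"
      using vector_sublattice_interpolation[OF T(1) sep False] .
    then show ?thesis
      using \<open>0 < \<epsilon>\<close> by (intro bexI[of _ g]) auto
  qed
  then obtain G where G: "\<And>x. G x \<in> T" "\<And>x. f x < G x x" "\<And>x. G x y < f y + \<epsilon>"
    by metis
  have "open {z. f z < G x z}" for x
    using G(1)[of x] T(2) f(1) by (intro open_Collect_less) (auto simp: cont_fun_space_def)
  moreover have "K \<subseteq> (\<Union>x\<in>K. {z. f z < G x z})"
    using G(2) by auto
  ultimately obtain A where A: "finite A" "K \<subseteq> (\<Union>x\<in>A. {z. f z < G x z})"
    by (rule compactE_image[OF K(1), of K "\<lambda>x. {z. f z < G x z}"])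
  \<comment> \<open>If \<open>K\<close> is empty, then so may be \<open>A\<close>; the index \<open>y\<close> keeps the maximum below meaningful.\<close>
  define B where "B = insert y A"
  have B: "finite B" "B \<noteq> {}"
    using A(1) by (auto simp: B_def)
  show thesis
  proof
    show "(\<lambda>z. max 0 (Max ((\<lambda>x. G x z) ` B))) \<in> T"
      by (intro vector_sublattice_max vector_sublattice_zero vector_sublattice_finite_Max T B G)
    show "f x \<le> max 0 (Max ((\<lambda>a. G a x) ` B))" for x
    proof (cases "x \<in> K")
      case True
      then obtain a where a: "a \<in> A" "f x < G a x"
        using A(2) by auto
      then have "G a x \<le> Max ((\<lambda>a. G a x) ` B)"
        using B(1) by (auto simp: B_def)
      then show ?thesis
        using a by simp
    qed (simp add: K)
    show "max 0 (Max ((\<lambda>x. G x y) ` B)) < f y + \<epsilon>"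
      using B G(3) f(2)[of y] \<open>0 < \<epsilon>\<close> by simp
  qed
qed

lemma Lindelof_countable_pointwise_infimum:
  fixes f :: "'x::topological_space \<Rightarrow> real"
  assumes L: "Lindelof_space (euclidean :: 'x topology)"
    and f: "continuous_on UNIV f" and \<G>: "\<And>g. g \<in> \<G> \<Longrightarrow> continuous_on UNIV g"
    and inf: "\<And>y \<epsilon>. 0 < \<epsilon> \<Longrightarrow> \<exists>g\<in>\<G>. g y < f y + \<epsilon>"
  obtains h :: "nat \<Rightarrow> 'x \<Rightarrow> real"
  where "range h \<subseteq> \<G>" "\<And>y \<epsilon>. 0 < \<epsilon> \<Longrightarrow> \<exists>k. h k y < f y + \<epsilon>"
proof -
  define U where "U n g = {z. g z < f z + 1 / real (Suc n)}" for n g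
  have "\<exists>\<H>. countable \<H> \<and> \<H> \<subseteq> \<G> \<and> (\<forall>y. \<exists>g\<in>\<H>. y \<in> U n g)" for n
  proof -
    have "\<exists>g\<in>\<G>. y \<in> U n g" for y
      using inf[of "1 / real (Suc n)" y] by (simp add: U_def)
    then have cover: "\<Union>(U n ` \<G>) = topspace euclidean"
      by auto
    have "openin euclidean V" if "V \<in> U n ` \<G>" for V
      using that f \<G> by (auto simp: U_def intro!: open_Collect_less continuous_intros)
    from Lindelof_spaceD[OF L this cover] obtain \<V>
      where \<V>: "countable \<V>" "\<V> \<subseteq> U n ` \<G>" "\<Union>\<V> = UNIV"
      by auto
    from countable_subset_image[THEN iffD1, OF conjI[OF \<V>(1,2)]]
    obtain \<H> where "countable \<H>" "\<H> \<subseteq> \<G>" "\<V> = U n ` \<H>"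
      by blast
    then show ?thesis
      using \<V>(3) by (intro exI[of _ \<H>]) auto
  qed
  then obtain \<H> where \<H>: "\<And>n. countable (\<H> n)" "\<And>n. \<H> n \<subseteq> \<G>"
    "\<And>n y. \<exists>g\<in>\<H> n. y \<in> U n g"
    by metis
  have ne: "(\<Union>n. \<H> n) \<noteq> {}"
    using \<H>(3) by blast
  have ct: "countable (\<Union>n. \<H> n)"
    using \<H>(1) by simp
  show thesis
  proof
    show "range (from_nat_into (\<Union>n. \<H> n)) \<subseteq> \<G>"
      unfolding range_from_nat_into[OF ne ct] using \<H>(2) by blast
    fix y :: 'x and \<epsilon> :: real assume "0 < \<epsilon>"
    then obtain n where n: "1 / real (Suc n) < \<epsilon>"
      by (rule nat_approx_posE)
    obtain g where g: "g \<in> \<H> n" "g y < f y + 1 / real (Suc n)"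
      using \<H>(3)[where n=n and y=y] by (auto simp: U_def)
    then have "g \<in> (\<Union>n. \<H> n)"
      by blast
    from from_nat_into_surj[OF ct this] obtain k where "from_nat_into (\<Union>n. \<H> n) k = g" ..
    then show "\<exists>k. from_nat_into (\<Union>n. \<H> n) k y < f y + \<epsilon>"
      using g n by (intro exI[of _ k]) auto
  qed
qed

text \<open>Passing to running minima keeps the infimum and makes the sequence decrease; a vector
  sublattice contains them.\<close>

lemma ex_decreasing_majorants:
  fixes T :: "('x::topological_space \<Rightarrow> real) set"
  assumes L: "Lindelof_space (euclidean :: 'x topology)"
    and T: "vector_sublattice T" "T \<subseteq> cont_fun_space"
    and sep: "strictly_point_separating T" and nv: "nowhere_vanishing T"
    and f: "continuous_on UNIV f" "\<And>x. 0 \<le> f x"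
    and K: "compact K" "\<And>x. x \<notin> K \<Longrightarrow> f x = 0"
  obtains G :: "nat \<Rightarrow> 'x \<Rightarrow> real"
  where "range G \<subseteq> T" "decseq G" "\<And>k x. f x \<le> G k x"
    "\<And>y \<epsilon>. 0 < \<epsilon> \<Longrightarrow> \<exists>k. G k y < f y + \<epsilon>"
proof -
  define \<G> where "\<G> = {g\<in>T. \<forall>x. f x \<le> g x}"
  have cont: "continuous_on UNIV g" if "g \<in> \<G>" for g
    using that T(2) by (auto simp: \<G>_def cont_fun_space_def)
  have close: "\<exists>g\<in>\<G>. g y < f y + \<epsilon>" if "0 < \<epsilon>" for y \<epsilon>
  proof -
    obtain g where "g \<in> T" "\<And>x. f x \<le> g x" "g y < f y + \<epsilon>"
      using ex_majorant_close_at_point[OF T sep nv f K \<open>0 < \<epsilon>\<close>, where y=y] by auto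
    then show ?thesis
      by (auto simp: \<G>_def)
  qed
  obtain h :: "nat \<Rightarrow> 'x \<Rightarrow> real"
    where h: "range h \<subseteq> \<G>" "\<And>y \<epsilon>. 0 < \<epsilon> \<Longrightarrow> \<exists>k. h k y < f y + \<epsilon>"
    using Lindelof_countable_pointwise_infimum[OF L f(1) cont close] by auto
  have hT: "h k \<in> T" and fh: "f x \<le> h k x" for k x
    using h(1) by (auto simp: \<G>_def)
  define G where "G k x = Min ((\<lambda>j. h j x) ` {..k})" for k x
  show thesis
  proof
    show "range G \<subseteq> T"
      using vector_sublattice_finite_Min[OF T(1), of "{..k}" h for k] hT
      by (auto simp: G_def[abs_def])
    show "decseq G"
      by (intro decseq_SucI le_funI) (auto simp: G_def intro!: Min_antimono)
    show "f x \<le> G k x" for k x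
      using fh by (simp add: G_def)
    show "\<exists>k. G k y < f y + \<epsilon>" if "0 < \<epsilon>" for y \<epsilon>
    proof -
      obtain k where "h k y < f y + \<epsilon>"
        using h(2)[OF \<open>0 < \<epsilon>\<close>] by blast
      moreover have "G k y \<le> h k y"
        by (auto simp: G_def)
      ultimately show ?thesis
        by (intro exI[of _ k]) auto
    qed
  qed
qed

section \<open>Approximation by compactly supported functions\<close>

lemma ex_compactly_supported_bump:
  fixes x :: "'x::t2_space"
  assumes "locally_compact_space (euclidean :: 'x topology)"
  obtains \<psi> :: "'x \<Rightarrow> real" and K
  where "continuous_on UNIV \<psi>" "\<And>z. 0 \<le> \<psi> z" "0 < \<psi> x" "compact K" "\<And>z. z \<notin> K \<Longrightarrow> \<psi> z = 0"
proof -
  have "Hausdorff_space (euclidean :: 'x topology)"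
    unfolding Hausdorff_space_def disjnt_def by simp (metis hausdorff)
  then have creg: "completely_regular_space (euclidean :: 'x topology)"
    by (intro locally_compact_regular_imp_completely_regular_space assms disjI1)
  obtain U K where U: "open U" "compact K" "x \<in> U" "U \<subseteq> K"
    using assms[unfolded locally_compact_space_def, rule_format, of x] by auto
  have "closedin euclidean (- U) \<and> x \<in> topspace euclidean - (- U)"
    using U by auto
  from creg[unfolded completely_regular_space_def, rule_format, OF this] obtain \<phi> :: "'x \<Rightarrow> real"
    where \<phi>: "continuous_map euclidean (top_of_set {0..1}) \<phi>" "\<phi> x = 0" "\<phi> ` (- U) \<subseteq> {1}"
    by blast
  have c: "continuous_on UNIV \<phi>" and "\<phi> \<in> UNIV \<rightarrow> {0..1}"
    using \<phi>(1) unfolding continuous_map_in_subtopology by simp_all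
  then have r: "\<phi> z \<le> 1" for z
    by (simp add: Pi_iff)
  show thesis
  proof
    show "continuous_on UNIV (\<lambda>z. 1 - \<phi> z)"
      by (intro continuous_intros c)
    show "0 \<le> 1 - \<phi> z" "0 < 1 - \<phi> x" for z
      using r[of z] \<phi>(2) by simp_all
    show "compact K"
      by (rule U)
    show "1 - \<phi> z = 0" if "z \<notin> K" for z
    proof -
      have "z \<in> - U"
        using that U(4) by blast
      then have "\<phi> z = 1"
        using \<phi>(3) by blast
      then show ?thesis by simp
    qed
  qed
qed

text \<open>Each bump is positive on an open neighbourhood of its point, so countably many of these
  neighbourhoods cover the space. The factor \<open>real n\<close> makes the cut-off eventually exceed \<open>f\<close>
  wherever one bump of the partial sum is positive.\<close>

lemma ex_compactly_supported_approximation: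
  fixes f :: "'x::t2_space \<Rightarrow> real"
  assumes L: "Lindelof_space (euclidean :: 'x topology)"
    and lc: "locally_compact_space (euclidean :: 'x topology)"
    and f: "continuous_on UNIV f" "\<And>x. 0 \<le> f x"
  obtains F :: "nat \<Rightarrow> 'x \<Rightarrow> real"
  where "\<And>n. continuous_on UNIV (F n)" "\<And>n x. 0 \<le> F n x" "\<And>n x. F n x \<le> f x"
    "\<And>n. \<exists>K. compact K \<and> (\<forall>x. x \<notin> K \<longrightarrow> F n x = 0)"
    "incseq F" "\<And>x. \<exists>n. F n x = f x"
proof -
  define \<B> where "\<B> = {\<psi> :: 'x \<Rightarrow> real. continuous_on UNIV \<psi> \<and> (\<forall>z. 0 \<le> \<psi> z) \<and>
    (\<exists>K. compact K \<and> (\<forall>z. z \<notin> K \<longrightarrow> \<psi> z = 0))}"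
  define P where "P \<psi> = {z. 0 < \<psi> z}" for \<psi> :: "'x \<Rightarrow> real"
  have "\<exists>\<psi>\<in>\<B>. 0 < \<psi> x" for x
    by (rule ex_compactly_supported_bump[OF lc, of x]) (auto simp: \<B>_def)
  then have cover: "\<Union>(P ` \<B>) = topspace euclidean"
    by (auto simp: P_def)
  have "openin euclidean V" if "V \<in> P ` \<B>" for V
    using that by (auto simp: P_def \<B>_def intro!: open_Collect_less continuous_intros)
  from Lindelof_spaceD[OF L this cover] obtain \<V>
    where \<V>: "countable \<V>" "\<V> \<subseteq> P ` \<B>" "\<Union>\<V> = UNIV"
    by auto
  from countable_subset_image[THEN iffD1, OF conjI[OF \<V>(1,2)]]
  obtain \<C> where \<C>: "countable \<C>" "\<C> \<subseteq> \<B>" "\<V> = P ` \<C>"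
    by blast
  then have ne: "\<C> \<noteq> {}"
    using \<V> by auto
  define b where "b = from_nat_into \<C>"
  have range_b: "range b = \<C>"
    unfolding b_def using ne \<C>(1) by (rule range_from_nat_into)
  then have bB: "b j \<in> \<B>" for j
    using \<C>(2) by auto
  then have b: "continuous_on UNIV (b j)" "0 \<le> b j z" for j z
    by (auto simp: \<B>_def)
  have "\<exists>K. compact K \<and> (\<forall>z. z \<notin> K \<longrightarrow> b j z = 0)" for j
    using bB[of j] by (auto simp: \<B>_def)
  then obtain K where K: "\<And>j. compact (K j)" "\<And>j z. z \<notin> K j \<Longrightarrow> b j z = 0"
    by metis
  have pos: "\<exists>j. 0 < b j x" for x
  proof -
    obtain \<psi> where "\<psi> \<in> \<C>" "0 < \<psi> x"
      using \<V>(3) \<C>(3) by (auto simp: P_def)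
    then show ?thesis
      using range_b by (metis rangeE)
  qed
  define F where "F n x = min (f x) (real n * (\<Sum>j\<le>n. b j x))" for n x
  have sum_nonneg: "0 \<le> (\<Sum>j\<le>n. b j x)" for n x
    by (intro sum_nonneg b)
  show thesis
  proof
    show "continuous_on UNIV (F n)" for n
      unfolding F_def[abs_def] by (intro continuous_intros f b)
    show "0 \<le> F n x" "F n x \<le> f x" for n x
      using f(2) sum_nonneg by (auto simp: F_def)
    show "\<exists>K. compact K \<and> (\<forall>x. x \<notin> K \<longrightarrow> F n x = 0)" for n
      using K f(2) by (intro exI[of _ "\<Union>j\<le>n. K j"]) (auto simp: F_def)
    show "incseq F"
    proof (intro incseq_SucI le_funI)
      fix n x
      have "real n * (\<Sum>j\<le>n. b j x) \<le> real (Suc n) * (\<Sum>j\<le>Suc n. b j x)"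
        using sum_nonneg b(2) by (intro mult_mono) auto
      then show "F n x \<le> F (Suc n) x"
        unfolding F_def by linarith
    qed
    show "\<exists>n. F n x = f x" for x
    proof -
      obtain j where j: "0 < b j x"
        using pos by blast
      obtain m where m: "f x < real m * b j x"
        using reals_Archimedean3[OF j] by blast
      define n where "n = max j m"
      have "b j x \<le> (\<Sum>i\<le>n. b i x)"
        using b(2) by (intro member_le_sum) (auto simp: n_def)
      then have "real m * b j x \<le> real n * (\<Sum>i\<le>n. b i x)"
        using j by (intro mult_mono) (auto simp: n_def)
      then show ?thesis
        using m by (intro exI[of _ n]) (auto simp: F_def)
    qed
  qed
qed

section \<open>The coincidence set of two morphisms\<close>

definition coincidence_set ::
    "('x \<Rightarrow> real) set \<Rightarrow> (('x \<Rightarrow> real) \<Rightarrow> 'r) \<Rightarrow> (('x \<Rightarrow> real) \<Rightarrow> 'r) \<Rightarrow> ('x \<Rightarrow> real) set" where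
  "coincidence_set I \<Phi> \<Psi> = {f\<in>I. \<Phi> f = \<Psi> f}"

lemma riesz_morphism_on_add:
    "riesz_morphism_on I \<Phi> \<Longrightarrow> f \<in> I \<Longrightarrow> g \<in> I \<Longrightarrow> \<Phi> (\<lambda>x. f x + g x) = \<Phi> f + \<Phi> g"
  and riesz_morphism_on_scale:
    "riesz_morphism_on I \<Phi> \<Longrightarrow> f \<in> I \<Longrightarrow> \<Phi> (\<lambda>x. c * f x) = c *\<^sub>R \<Phi> f"
  and riesz_morphism_on_abs:
    "riesz_morphism_on I \<Phi> \<Longrightarrow> f \<in> I \<Longrightarrow> \<Phi> (\<lambda>x. \<bar>f x\<bar>) = \<bar>\<Phi> f\<bar>"
  by (simp_all add: riesz_morphism_on_def)

lemma riesz_morphism_on_diff: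
  assumes "vector_sublattice I" "riesz_morphism_on I \<Phi>" "f \<in> I" "g \<in> I"
  shows "\<Phi> (\<lambda>x. f x - g x) = \<Phi> f - \<Phi> g"
proof -
  have "(\<lambda>x. (-1) * g x) \<in> I"
    using assms by (intro vector_sublattice_scale)
  then have "\<Phi> (\<lambda>x. f x + (-1) * g x) = \<Phi> f + \<Phi> (\<lambda>x. (-1) * g x)"
    by (rule riesz_morphism_on_add[OF assms(2,3)])
  also have "\<Phi> (\<lambda>x. (-1) * g x) = (-1) *\<^sub>R \<Phi> g"
    by (rule riesz_morphism_on_scale[OF assms(2,4)])
  finally show ?thesis by simp
qed

lemma vector_sublattice_coincidence_set:
  assumes I: "vector_sublattice I"
    and \<Phi>: "riesz_morphism_on I \<Phi>" and \<Psi>: "riesz_morphism_on I \<Psi>"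
  shows "vector_sublattice (coincidence_set I \<Phi> \<Psi>)"
proof -
  have "\<Phi> (\<lambda>x. 0) = 0" "\<Psi> (\<lambda>x. 0) = 0"
    using riesz_morphism_on_diff[OF I \<Phi>, of "\<lambda>x. 0" "\<lambda>x. 0"]
      riesz_morphism_on_diff[OF I \<Psi>, of "\<lambda>x. 0" "\<lambda>x. 0"] vector_sublattice_zero[OF I] by auto
  then show ?thesis
    using I unfolding vector_sublattice_def coincidence_set_def
    by (simp add: riesz_morphism_on_add[OF \<Phi>] riesz_morphism_on_add[OF \<Psi>]
        riesz_morphism_on_scale[OF \<Phi>] riesz_morphism_on_scale[OF \<Psi>]
        riesz_morphism_on_abs[OF \<Phi>] riesz_morphism_on_abs[OF \<Psi>])
qed

text \<open>The functions \<open>\<lambda>x. G k x - f x\<close> decrease to \<open>0\<close>, so the elements \<open>\<Phi> (G k) - \<Phi> f\<close> have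
  infimum \<open>0\<close>, and an infimum may be translated by \<open>\<Phi> f\<close>.\<close>

lemma strictly_continuous_onD:
  assumes I: "vector_sublattice I" and \<Phi>: "riesz_morphism_on I \<Phi>" "strictly_continuous_on I \<Phi>"
    and f: "f \<in> I" and G: "range G \<subseteq> I" "decseq G" "\<And>k x. f x \<le> G k x"
    and inf: "\<And>y \<epsilon>. 0 < \<epsilon> \<Longrightarrow> \<exists>k. G k y < f y + \<epsilon>"
  shows "isGlb UNIV (range (\<lambda>k. \<Phi> (G k))) (\<Phi> f)"
proof -
  define F where "F k x = G k x - f x" for k x
  have "range F \<subseteq> I"
    using G(1) f by (auto simp: F_def[abs_def] intro!: vector_sublattice_diff[OF I])
  moreover have "decseq F"
    using decseqD[OF G(2)] by (intro decseq_SucI le_funI) (simp add: F_def le_fun_def)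
  moreover have "isGlb UNIV (range (\<lambda>k. F k x)) 0" for x
  proof (intro isGlbI2 isLbI setgeI setleI ballI)
    show "0 \<le> y" if "y \<in> range (\<lambda>k. F k x)" for y
      using that G(3) by (auto simp: F_def)
    show "y \<le> 0" if "y \<in> Collect (isLb UNIV (range (\<lambda>k. F k x)))" for y
    proof (rule ccontr)
      assume "\<not> y \<le> 0"
      then obtain k where "G k x < f x + y"
        using inf[of y x] by auto
      then have "F k x < y"
        by (simp add: F_def)
      then show False
        using that by (auto simp: isLb_def setge_def not_le[symmetric])
    qed
  qed simp
  ultimately have glb: "isGlb UNIV (range (\<lambda>k. \<Phi> (F k))) 0"
    using \<Phi>(2) unfolding strictly_continuous_on_def by blast
  have eq: "\<Phi> (F k) = \<Phi> (G k) - \<Phi> f" for k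
    unfolding F_def[abs_def] using G(1) by (intro riesz_morphism_on_diff[OF I \<Phi>(1) _ f]) auto
  show ?thesis
  proof (intro isGlbI2 isLbI setgeI setleI ballI)
    fix y assume "y \<in> range (\<lambda>k. \<Phi> (G k))"
    then show "\<Phi> f \<le> y"
    proof
      fix k assume "y = \<Phi> (G k)"
      moreover have "0 \<le> \<Phi> (F k)"
        using isGlbD2[OF glb] by blast
      ultimately show ?thesis
        by (simp add: eq)
    qed
  next
    show "y \<le> \<Phi> f" if "y \<in> Collect (isLb UNIV (range (\<lambda>k. \<Phi> (G k))))" for y
    proof -
      have "isLb UNIV (range (\<lambda>k. \<Phi> (F k))) (y - \<Phi> f)"
        using that by (auto simp: isLb_def setge_def eq)
      then show ?thesis
        using isGlb_le_isLb[OF glb] by fastforce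
    qed
  qed simp
qed

text \<open>Both \<open>\<Phi> f\<close> and \<open>\<Psi> f\<close> are the infimum of the same elements \<open>\<Phi> (G k) = \<Psi> (G k)\<close>.\<close>

lemma coincidence_set_decreasing_limit:
  assumes I: "vector_sublattice I"
    and \<Phi>: "riesz_morphism_on I \<Phi>" "strictly_continuous_on I \<Phi>"
    and \<Psi>: "riesz_morphism_on I \<Psi>" "strictly_continuous_on I \<Psi>"
    and f: "f \<in> I" and G: "range G \<subseteq> coincidence_set I \<Phi> \<Psi>" "decseq G" "\<And>k x. f x \<le> G k x"
    and inf: "\<And>y \<epsilon>. 0 < \<epsilon> \<Longrightarrow> \<exists>k. G k y < f y + \<epsilon>"
  shows "f \<in> coincidence_set I \<Phi> \<Psi>"
proof -
  have GI: "range G \<subseteq> I" and eq: "\<Phi> (G k) = \<Psi> (G k)" for k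
    using G(1) by (auto simp: coincidence_set_def)
  have 1: "isGlb UNIV (range (\<lambda>k. \<Phi> (G k))) (\<Phi> f)"
    by (rule strictly_continuous_onD[OF I \<Phi> f GI G(2,3) inf])
  have 2: "isGlb UNIV (range (\<lambda>k. \<Phi> (G k))) (\<Psi> f)"
    unfolding eq by (rule strictly_continuous_onD[OF I \<Psi> f GI G(2,3) inf])
  have "\<Phi> f = \<Psi> f"
    using isGlb_le_isLb[OF 1 isGlb_isLb[OF 2]] isGlb_le_isLb[OF 2 isGlb_isLb[OF 1]]
    by (rule order_antisym[rotated])
  then show ?thesis
    using f by (simp add: coincidence_set_def)
qed

section \<open>Uniqueness of strictly continuous morphisms\<close>

theorem corollary4p7:
  fixes I S :: "('x::t2_space \<Rightarrow> real) set"
    and \<Phi> \<Psi> :: "('x \<Rightarrow> real) \<Rightarrow> 'r::riesz_space"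
  assumes "Lindelof_space (euclidean :: 'x topology)"
    and "locally_compact_space (euclidean :: 'x topology)"
    and "riesz_ideal I"
    and "riesz_morphism_on I \<Phi>"
    and "riesz_morphism_on I \<Psi>"
    and "strictly_continuous_on I \<Phi>"
    and "strictly_continuous_on I \<Psi>"
    and "S \<subseteq> I"
    and "strictly_point_separating S"
    and "nowhere_vanishing S"
    and "\<forall>s\<in>S. \<Phi> s = \<Psi> s"
  shows "\<forall>f\<in>I. \<Phi> f = \<Psi> f"
proof -
  note L = assms(1)
  define T where "T = coincidence_set I \<Phi> \<Psi>"
  have I: "vector_sublattice I" and Icont: "I \<subseteq> cont_fun_space"
    by (fact riesz_ideal_vector_sublattice[OF assms(3)]
        riesz_ideal_subset_cont_fun_space[OF assms(3)])+
  have T: "vector_sublattice T"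
    unfolding T_def by (rule vector_sublattice_coincidence_set[OF I assms(4,5)])
  have Tcont: "T \<subseteq> cont_fun_space"
    using Icont by (auto simp: T_def coincidence_set_def)
  have "S \<subseteq> T"
    using assms(8,11) by (auto simp: T_def coincidence_set_def)
  then have sep: "strictly_point_separating T" and nv: "nowhere_vanishing T"
    using assms(9,10) unfolding strictly_point_separating_def nowhere_vanishing_def
    by (meson subsetD)+
  note limit = coincidence_set_decreasing_limit[OF I assms(4,6,5,7), folded T_def]

  have compact_support: "f \<in> T"
    if "f \<in> I" and f: "\<And>x. 0 \<le> f x" "compact K" "\<And>x. x \<notin> K \<Longrightarrow> f x = 0" for f K
  proof -
    have "continuous_on UNIV f"
      using \<open>f \<in> I\<close> Icont by (auto simp: cont_fun_space_def)
    then obtain G where G: "range G \<subseteq> T" "decseq G" "\<And>k x. f x \<le> G k x"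
      "\<And>y \<epsilon>. 0 < \<epsilon> \<Longrightarrow> \<exists>k. G k y < f y + \<epsilon>"
      by (rule ex_decreasing_majorants[OF L T Tcont sep nv _ f]) (assumption | rule that)+
    show ?thesis
      by (rule limit[OF \<open>f \<in> I\<close> G])
  qed

  have nonneg: "f \<in> T" if "f \<in> I" and f: "\<And>x. 0 \<le> f x" for f
  proof -
    have "continuous_on UNIV f"
      using \<open>f \<in> I\<close> Icont by (auto simp: cont_fun_space_def)
    then obtain F where F: "\<And>n. continuous_on UNIV (F n)" "\<And>n x. 0 \<le> F n x"
      "\<And>n x. F n x \<le> f x" "\<And>n. \<exists>K. compact K \<and> (\<forall>x. x \<notin> K \<longrightarrow> F n x = 0)"
      "incseq F" "\<And>x. \<exists>n. F n x = f x"
      by (rule ex_compactly_supported_approximation[OF L assms(2) _ f]) (rule that)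
    have "F n \<in> I" for n
    proof -
      have "F n \<in> cont_fun_space" "\<And>x. \<bar>F n x\<bar> \<le> \<bar>f x\<bar>"
        using F(1-3) f by (auto simp: cont_fun_space_def)
      then show ?thesis
        by (rule riesz_ideal_solid[OF assms(3) _ \<open>f \<in> I\<close>])
    qed
    then have FT: "F n \<in> T" for n
      using F(2,4) compact_support by metis
    have "(\<lambda>x. (-1) * f x) \<in> T"
    proof (rule limit)
      show "(\<lambda>x. (-1) * f x) \<in> I"
        by (intro vector_sublattice_scale I \<open>f \<in> I\<close>)
      show "range (\<lambda>n x. (-1) * F n x) \<subseteq> T"
        using vector_sublattice_scale[OF T FT, of "-1"] by auto
      show "decseq (\<lambda>n x. (-1) * F n x)"
        using incseq_SucD[OF F(5)] by (intro decseq_SucI le_funI) (simp add: le_fun_def)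
      show "(-1) * f x \<le> (-1) * F n x" for n x
        using F(3) by simp
      show "\<exists>n. (-1) * F n y < (-1) * f y + \<epsilon>" if "0 < \<epsilon>" for y \<epsilon>
      proof -
        obtain n where "F n y = f y"
          using F(6) by blast
        then show ?thesis
          using that by (intro exI[of _ n]) simp
      qed
    qed
    then show ?thesis
      using vector_sublattice_scale[OF T, of _ "-1"] by fastforce
  qed

  show ?thesis
  proof
    fix f assume "f \<in> I"
    have "(\<lambda>x. \<bar>f x\<bar>) \<in> T"
      by (intro nonneg vector_sublattice_abs I \<open>f \<in> I\<close>) auto
    moreover have "(\<lambda>x. \<bar>f x\<bar> - f x) \<in> T"
      by (intro nonneg vector_sublattice_diff vector_sublattice_abs I \<open>f \<in> I\<close>) auto
    ultimately have "(\<lambda>x. \<bar>f x\<bar> - (\<bar>f x\<bar> - f x)) \<in> T"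
      by (rule vector_sublattice_diff[OF T])
    then show "\<Phi> f = \<Psi> f"
      by (simp add: T_def coincidence_set_def)
  qed
qed

end
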